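(* For every integer $n\ge 3$, $\gamma_I(P(n,1))=n$.
   Context: $P(n,k)$ (with $n\ge 3$, $1\le k<n/2$) denotes the generalized Petersen graph: the 3-regular simple graph on the $2n$ vertices $v_0,v_1,\dots,v_{2n-1}$ (subscripts read modulo $2n$) with edges $v_{2i}v_{2i+2}$, $v_{2i}v_{2i+1}$ and $v_{2i+1}v_{2i+1+2k}$ for $0\le i\le n-1$. For a graph $G=(V,E)$, an Italian dominating function (IDF) of $G$ is a function $f:V\to\{0,1,2\}$ such that every $v\in V$ with $f(v)=0$ satisfies $\sum_{u\in N(v)}f(u)\ge 2$, where $N(v)$ is the open neighborhood of $v$. Its weight is $w(f)=\sum_{v\in V}f(v)$, and the Italian domination number is $\gamma_I(G)=\min_f w(f)$ over all IDFs $f$ of $G$. *)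

theory Defs
  imports "HOL-Library.FuncSet"
begin

type_synonym 'a graph = "'a set \<times> 'a set set"

definition neighborhood :: "'a graph \<Rightarrow> 'a \<Rightarrow> 'a set" where
  "neighborhood G v = {u \<in> fst G. {u, v} \<in> snd G}"

definition italian_dominating :: "'a graph \<Rightarrow> ('a \<Rightarrow> nat) \<Rightarrow> bool" where
  "italian_dominating G f \<longleftrightarrow>
     f \<in> fst G \<rightarrow> {0, 1, 2} \<and>
     (\<forall>v \<in> fst G. f v = 0 \<longrightarrow> (\<Sum>u \<in> neighborhood G v. f u) \<ge> 2)"

definition weight :: "'a graph \<Rightarrow> ('a \<Rightarrow> nat) \<Rightarrow> nat" where
  "weight G f = (\<Sum>v \<in> fst G. f v)"

(* For a finite graph the minimum is attained, as the constant function 2 is admissible. *)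
definition italian_domination_number :: "'a graph \<Rightarrow> nat" where
  "italian_domination_number G = (LEAST w. \<exists>f. italian_dominating G f \<and> w = weight G f)"

(* The vertex v_j with subscript j modulo 2n is represented by the residue j < 2n. *)
definition generalized_petersen :: "nat \<Rightarrow> nat \<Rightarrow> nat graph" where
  "generalized_petersen n k =
     ({..<2 * n},
      {{2 * i, (2 * i + 2) mod (2 * n)} | i. i < n} \<union>
      {{2 * i, 2 * i + 1} | i. i < n} \<union>
      {{2 * i + 1, (2 * i + 1 + 2 * k) mod (2 * n)} | i. i < n})"

end

theory Submission
  imports Defs
begin

text \<open>
  The graph $P(n,1)$ is the prism over an $n$-cycle: column $i$ consists of the two joined
  vertices $2i$ and $2i+1$, and cyclically consecutive columns are joined row by row
  (\<open>neighborhood_prism\<close>).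

  For the upper bound, put weight $1$ on exactly one vertex of each column, alternating the row
  from column to column. A vertex of value $0$ sees the $1$ in its own column and at least one more
  in its row: when $n$ is odd the alternation breaks between the last column and column $0$, but
  each of these two columns still has a regular neighbour on its other side
  (\<open>italian_dominating_alternating\<close>).

  For the lower bound, let $c_i$ be the weight of column $i$ and let every column of positive weight
  keep $1$ and send half of the surplus $d_i = \max(c_i - 1, 0)$ to each of its two neighbours.
  A column of weight $0$ has $c_{i-1} + c_{i+1} \ge 4$, because both of its vertices must see
  weight $2$ outside the column; so it receives at least
  $\frac12((c_{i-1} - 1) + (c_{i+1} - 1)) \ge 1$. Thus every column ends with weight at least
  $1$, and the total is at least $n$ (\<open>discharging_cycle\<close>, \<open>weight_prism_ge\<close>).
\<close>

section \<open>Cyclic indices\<close>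

definition cyc_succ :: "nat \<Rightarrow> nat \<Rightarrow> nat" where
  "cyc_succ n i = (if Suc i = n then 0 else Suc i)"

definition cyc_pred :: "nat \<Rightarrow> nat \<Rightarrow> nat" where
  "cyc_pred n i = (if i = 0 then n - 1 else i - 1)"

lemma cyc_succ_less: "i < n \<Longrightarrow> cyc_succ n i < n"
  and cyc_pred_less: "i < n \<Longrightarrow> cyc_pred n i < n"
  by (auto simp: cyc_succ_def cyc_pred_def)

lemma cyc_succ_eq_iff: "i < n \<Longrightarrow> j < n \<Longrightarrow> cyc_succ n j = i \<longleftrightarrow> j = cyc_pred n i"
  by (auto simp: cyc_succ_def cyc_pred_def)

lemma cyc_succ_neq_cyc_pred: "n \<ge> 3 \<Longrightarrow> i < n \<Longrightarrow> cyc_succ n i \<noteq> cyc_pred n i"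
  by (auto simp: cyc_succ_def cyc_pred_def split: if_splits)

lemma bij_betw_cyc_succ: "bij_betw (cyc_succ n) {..<n} {..<n}"
  by (rule bij_betw_byWitness[where f' = "cyc_pred n"])
    (auto simp: cyc_succ_def cyc_pred_def)

lemma bij_betw_cyc_pred: "bij_betw (cyc_pred n) {..<n} {..<n}"
  by (rule bij_betw_byWitness[where f' = "cyc_succ n"])
    (auto simp: cyc_succ_def cyc_pred_def)

text \<open>
  In the proof, \<open>local_bound\<close> says that a column ends with weight at least $1$, with everything
  doubled and the amount sent moved to the left. A cyclic shift does not change the sum of the
  surpluses $d_i$, so what is sent and what is received cancel when the bounds are added up.
\<close>

lemma discharging_cycle:
  fixes c :: "nat \<Rightarrow> nat"
  assumes gap: "\<And>i. i < n \<Longrightarrow> c i = 0 \<Longrightarrow> c (cyc_pred n i) + c (cyc_succ n i) \<ge> 4"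
  shows "n \<le> (\<Sum>i<n. c i)"
proof -
  define d where "d i = c i - 1" for i
  have local_bound: "2 + 2 * d i \<le> 2 * c i + d (cyc_pred n i) + d (cyc_succ n i)" if "i < n" for i
    using gap[OF that] by (cases "c i = 0") (auto simp: d_def)
  have "(\<Sum>i<n. 2 + 2 * d i) \<le> (\<Sum>i<n. 2 * c i + d (cyc_pred n i) + d (cyc_succ n i))"
    using local_bound by (intro sum_mono) blast
  moreover have "(\<Sum>i<n. d (cyc_pred n i)) = (\<Sum>i<n. d i)"
    by (rule sum.reindex_bij_betw[OF bij_betw_cyc_pred])
  moreover have "(\<Sum>i<n. d (cyc_succ n i)) = (\<Sum>i<n. d i)"
    by (rule sum.reindex_bij_betw[OF bij_betw_cyc_succ])
  ultimately show ?thesis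
    by (simp add: sum.distrib del: add_2_eq_Suc add_2_eq_Suc' flip: sum_distrib_left)
qed

section \<open>The graph as a prism\<close>

lemma fst_generalized_petersen: "fst (generalized_petersen n k) = {..<2 * n}"
  by (simp add: generalized_petersen_def)

lemma column_row_cases:
  fixes v :: nat
  assumes "v < 2 * n"
  obtains i b where "i < n" "b < 2" "v = 2 * i + b"
proof
  show "v div 2 < n" "v mod 2 < 2" "v = 2 * (v div 2) + v mod 2"
    using assms by auto
qed

lemma column_row_eq_iff:
  fixes i j a b :: nat
  assumes "a < 2" "b < 2"
  shows "2 * i + a = 2 * j + b \<longleftrightarrow> i = j \<and> a = b"
  using assms by presburger

lemma sum_over_columns: "(\<Sum>v<2 * n. f v) = (\<Sum>i<n. f (2 * i) + f (2 * i + 1))"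
  for f :: "nat \<Rightarrow> 'a::comm_monoid_add"
  by (induction n) (simp_all add: add.assoc)

lemma edges_prism:
  "snd (generalized_petersen n 1) =
     {{2 * i + b, 2 * cyc_succ n i + b} | i b. i < n \<and> b < 2} \<union> {{2 * i, 2 * i + 1} | i. i < n}"
proof -
  have even_row: "(2 * i + 2) mod (2 * n) = 2 * cyc_succ n i" if "i < n" for i
    using that by (auto simp: cyc_succ_def)
  have odd_row: "(2 * i + 1 + 2 * 1) mod (2 * n) = 2 * cyc_succ n i + 1" if "i < n" for i
  proof (cases "Suc i = n")
    case True
    then have "2 * i + 1 + 2 * 1 = 1 + 2 * n" by simp
    with True show ?thesis by (simp only: mod_add_self2) (simp add: cyc_succ_def)
  next
    case False
    with that show ?thesis by (simp add: cyc_succ_def)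
  qed
  have "{{2 * i, (2 * i + 2) mod (2 * n)} | i. i < n} = {{2 * i, 2 * cyc_succ n i} | i. i < n}"
    using even_row by (metis (no_types, lifting))
  moreover have "{{2 * i + 1, (2 * i + 1 + 2 * 1) mod (2 * n)} | i. i < n} =
      {{2 * i + 1, 2 * cyc_succ n i + 1} | i. i < n}"
    using odd_row by (metis (no_types, lifting))
  moreover have "{{2 * i + b, 2 * cyc_succ n i + b} | i b. i < n \<and> b < 2} =
      {{2 * i, 2 * cyc_succ n i} | i. i < n} \<union> {{2 * i + 1, 2 * cyc_succ n i + 1} | i. i < n}"
    by (rule set_eqI)
      (simp add: less_2_cases_iff conj_disj_distribL conj_disj_distribR ex_disj_distrib)
  ultimately show ?thesis
    unfolding generalized_petersen_def snd_conv by (simp only: Un_ac)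
qed

lemma neighborhood_prism:
  assumes i: "i < n" and b: "b < 2"
  shows "neighborhood (generalized_petersen n 1) (2 * i + b) =
    {2 * i + (1 - b), 2 * cyc_pred n i + b, 2 * cyc_succ n i + b}"
proof -
  have adj: "{2 * j + a, 2 * i + b} \<in> snd (generalized_petersen n 1) \<longleftrightarrow>
      j = i \<and> a = 1 - b \<or> a = b \<and> (j = cyc_pred n i \<or> j = cyc_succ n i)"
    if j: "j < n" and a: "a < 2" for j a
  proof -
    have "{2 * j + a, 2 * i + b} \<in> {{2 * l + e, 2 * cyc_succ n l + e} | l e. l < n \<and> e < 2} \<longleftrightarrow>
        a = b \<and> (i = cyc_succ n j \<or> j = cyc_succ n i)"
      using i b j a by (auto simp: doubleton_eq_iff column_row_eq_iff)
    moreover have "{2 * j + a, 2 * i + b} \<in> {{2 * l, 2 * l + 1} | l. l < n} \<longleftrightarrow>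
        j = i \<and> a = 1 - b"
      using i b a by (auto simp: doubleton_eq_iff less_2_cases_iff; presburger)
    ultimately show ?thesis
      using cyc_succ_eq_iff[OF i j] unfolding edges_prism Un_iff by auto
  qed
  have "u \<in> neighborhood (generalized_petersen n 1) (2 * i + b) \<longleftrightarrow>
      u \<in> {2 * i + (1 - b), 2 * cyc_pred n i + b, 2 * cyc_succ n i + b}" for u
  proof (cases "u < 2 * n")
    case True
    then obtain j a where u: "j < n" "a < 2" "u = 2 * j + a"
      by (rule column_row_cases)
    moreover have "1 - b < 2" by simp
    ultimately show ?thesis
      using True b adj[OF u(1,2)]
      by (simp only: neighborhood_def fst_generalized_petersen column_row_eq_iff
          mem_Collect_eq lessThan_iff insert_iff empty_iff) blast
  next
    case False
    then show ?thesis
      using i b cyc_succ_less[OF i] cyc_pred_less[OF i]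
      by (auto simp: neighborhood_def fst_generalized_petersen)
  qed
  then show ?thesis by blast
qed

lemma sum_neighborhood_prism:
  fixes f :: "nat \<Rightarrow> nat"
  assumes "n \<ge> 3" "i < n" "b < 2"
  shows "(\<Sum>u \<in> neighborhood (generalized_petersen n 1) (2 * i + b). f u) =
    f (2 * i + (1 - b)) + f (2 * cyc_pred n i + b) + f (2 * cyc_succ n i + b)"
proof -
  have "1 - b \<noteq> b" "1 - b < 2" using assms by presburger+
  then have "2 * i + (1 - b) \<noteq> 2 * cyc_pred n i + b" "2 * i + (1 - b) \<noteq> 2 * cyc_succ n i + b"
    "2 * cyc_pred n i + b \<noteq> 2 * cyc_succ n i + b"
    using assms cyc_succ_neq_cyc_pred[of n i] by (simp_all only: column_row_eq_iff) auto
  then show ?thesis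
    unfolding neighborhood_prism[OF assms(2,3)] by simp
qed

section \<open>The two bounds\<close>

text \<open>
  Consecutive columns have indices of opposite parity, except possibly the last column and
  column \<open>0\<close>. Every column therefore has a neighbouring column of opposite parity, and that one
  carries its \<open>1\<close> in the row in which the given column carries its \<open>0\<close>.
\<close>

lemma italian_dominating_alternating:
  assumes n: "n \<ge> 3"
  shows "italian_dominating (generalized_petersen n 1) (\<lambda>v. of_bool (even v = even (v div 2)))"
    (is "italian_dominating ?G ?f")
  unfolding italian_dominating_def
proof (intro conjI ballI impI)
  show "?f \<in> fst ?G \<rightarrow> {0, 1, 2}" by auto
next
  fix v assume "v \<in> fst ?G" and zero: "?f v = 0"
  then have "v < 2 * n" by (simp add: fst_generalized_petersen)
  then obtain i b where v: "i < n" "b < 2" "v = 2 * i + b"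
    by (rule column_row_cases)
  have parity: "even b \<noteq> even i"
    using zero v by auto
  have own: "?f (2 * i + (1 - b)) = 1"
    using parity v(2) by (auto simp: less_2_cases_iff)
  have side: "?f (2 * j + b) = 1" if "even j \<noteq> even i" for j
    using that parity v(2) by auto
  have "even (cyc_succ n i) \<noteq> even i \<or> even (cyc_pred n i) \<noteq> even i"
    using n v(1) by (auto simp: cyc_succ_def cyc_pred_def)
  then have "?f (2 * cyc_pred n i + b) + ?f (2 * cyc_succ n i + b) \<ge> 1"
    using side by (metis le_add1 le_add2)
  then show "(\<Sum>u \<in> neighborhood ?G v. ?f u) \<ge> 2"
    unfolding v(3) sum_neighborhood_prism[OF n v(1,2)] using own by linarith
qed

lemma weight_alternating:
  "weight (generalized_petersen n k) (\<lambda>v. of_bool (even v = even (v div 2))) = n"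
proof -
  have "of_bool (even (2 * i) = even (2 * i div 2)) +
      of_bool (even (2 * i + 1) = even ((2 * i + 1) div 2)) = (1::nat)" for i :: nat
    by auto
  then show ?thesis
    unfolding weight_def fst_generalized_petersen sum_over_columns by simp
qed

lemma weight_prism_ge:
  assumes n: "n \<ge> 3" and f: "italian_dominating (generalized_petersen n 1) f"
  shows "n \<le> weight (generalized_petersen n 1) f"
proof -
  define c where "c i = f (2 * i) + f (2 * i + 1)" for i
  have "c (cyc_pred n i) + c (cyc_succ n i) \<ge> 4" if i: "i < n" and empty: "c i = 0" for i
  proof -
    have "f (2 * i + (1 - b)) + f (2 * cyc_pred n i + b) + f (2 * cyc_succ n i + b) \<ge> 2"
      if "b < 2" for b
    proof -
      have "f (2 * i + b) = 0" "2 * i + b < 2 * n"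
        using empty i that by (auto simp: c_def less_2_cases_iff)
      then have "(\<Sum>u \<in> neighborhood (generalized_petersen n 1) (2 * i + b). f u) \<ge> 2"
        using f unfolding italian_dominating_def fst_generalized_petersen by blast
      then show ?thesis
        by (simp only: sum_neighborhood_prism[OF n i that])
    qed
    from this[of 0] this[of 1] show ?thesis
      using empty by (simp add: c_def)
  qed
  then have "n \<le> (\<Sum>i<n. c i)"
    by (rule discharging_cycle)
  then show ?thesis
    by (simp only: weight_def fst_generalized_petersen sum_over_columns c_def)
qed

theorem theorem3:
  fixes n :: nat
  assumes "n \<ge> 3"
  shows "italian_domination_number (generalized_petersen n 1) = n"
  unfolding italian_domination_number_def
proof (rule Least_equality)
  show "\<exists>f. italian_dominating (generalized_petersen n 1) f \<and>
      n = weight (generalized_petersen n 1) f"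
    using italian_dominating_alternating[OF assms] weight_alternating by metis
next
  fix w
  assume "\<exists>f. italian_dominating (generalized_petersen n 1) f \<and>
      w = weight (generalized_petersen n 1) f"
  then show "n \<le> w"
    using weight_prism_ge[OF assms] by blast
qed

end
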